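(* Let $G$ be a group given by a monoid presentation $\mathrm{mon}\langle X_G, R_G\rangle$ with natural homomorphism $\theta:X_G^*\to G$, and let $X_H,X_K\subseteq X_G^*$ with $\theta(X_H)$ generating a subgroup $H$ and $\theta(X_K)$ generating a subgroup $K$. With new symbols $H,K$, let $T_+ = (\{H,K\}\cup X_G)^*$, $T=\{HwK: w\in X_G^*\}$ and $R = R_G \cup \{(Hh, H) : h \in X_H\} \cup \{(kK, K) : k \in X_K\}$. Let $R^C$ be a finite, complete rewriting system on $T_+$ generating the same congruence as $R$ (a finite complete double coset rewriting system for $H\backslash G/K$). Then there is a regular expression representing a regular language $L$ over the alphabet $X_G\cup\{H,K\}$ with $L\subseteq T$ which is a set of normal forms for the double cosets: the map $HwK\mapsto H\theta(w)K$ is a bijection from $L$ onto $H\backslash G/K=\{[g]_\sim : g\in G\}$.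
   Context: Double cosets: $g\sim g'$ iff $hgk=g'$ for some $h\in H,k\in K$, with classes $[g]_\sim$. A rewriting system $R^C$ on $T_+$ generates $\to_{R^C}$ via $ulv\to urv$ for $(l,r)\in R^C$; complete means terminating and confluent. *)

theory Defs
  imports "HOL-Algebra.Coset" "HOL-Algebra.Generated_Groups" "HOL-Library.Confluence"
begin

text \<open>Words over an alphabet \<open>A\<close> are the elements of \<^term>\<open>lists A\<close>; a rewriting system on the
  free monoid \<open>A\<^sup>*\<close> is a set of pairs of words. Alphabets are sets, possibly empty or infinite.\<close>

type_synonym 'a rules = "('a list \<times> 'a list) set"

inductive rewrite_step :: "'a set \<Rightarrow> 'a rules \<Rightarrow> 'a list \<Rightarrow> 'a list \<Rightarrow> bool"
  for A :: "'a set" and R :: "'a rules" where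
  "(l, r) \<in> R \<Longrightarrow> u \<in> lists A \<Longrightarrow> v \<in> lists A \<Longrightarrow> rewrite_step A R (u @ l @ v) (u @ r @ v)"

definition is_rewriting_system :: "'a set \<Rightarrow> 'a rules \<Rightarrow> bool" where
  "is_rewriting_system A R \<longleftrightarrow> R \<subseteq> lists A \<times> lists A"

text \<open>Terminating: no infinite chain \<open>w\<^sub>0 \<rightarrow> w\<^sub>1 \<rightarrow> \<dots>\<close>, i.e. the converse of \<open>\<rightarrow>\<close> is well-founded.\<close>

definition complete_rewriting_system :: "'a set \<Rightarrow> 'a rules \<Rightarrow> bool" where
  "complete_rewriting_system A R \<longleftrightarrow>
     is_rewriting_system A R \<and> wfp ((rewrite_step A R)\<inverse>\<inverse>) \<and> confluentp (rewrite_step A R)"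

text \<open>The congruence generated by \<open>R\<close>: the reflexive, symmetric, transitive closure of the rewrite
  relation on \<open>A\<^sup>*\<close>. The restriction only removes the reflexive pairs outside \<open>A\<^sup>*\<close>.\<close>

definition generated_congruence :: "'a set \<Rightarrow> 'a rules \<Rightarrow> 'a rules" where
  "generated_congruence A R =
     {(u, v). u \<in> lists A \<and> v \<in> lists A \<and> equivclp (rewrite_step A R) u v}"

definition presented_monoid :: "'a set \<Rightarrow> 'a rules \<Rightarrow> 'a list set monoid" where
  "presented_monoid A R =
     \<lparr>carrier = lists A // generated_congruence A R,
      mult = (\<lambda>U V. generated_congruence A R `` {u @ v | u v. u \<in> U \<and> v \<in> V}),
      one = generated_congruence A R `` {[]}\<rparr>"

text \<open>\<open>G\<close> is given by the monoid presentation \<open>mon\<langle>A, R\<rangle>\<close>, with natural homomorphism \<open>\<theta>\<close>; the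
  values of \<open>\<theta>\<close> outside \<open>A\<^sup>*\<close> are irrelevant.\<close>

definition group_presentation ::
    "('g, 'm) monoid_scheme \<Rightarrow> 'a set \<Rightarrow> 'a rules \<Rightarrow> ('a list \<Rightarrow> 'g) \<Rightarrow> bool" where
  "group_presentation G A R \<theta> \<longleftrightarrow>
     group G \<and> is_rewriting_system A R \<and>
     (\<exists>\<phi> \<in> iso (presented_monoid A R) G.
        \<forall>w \<in> lists A. \<theta> w = \<phi> (generated_congruence A R `` {w}))"

definition double_coset_rel :: "('g, 'm) monoid_scheme \<Rightarrow> 'g set \<Rightarrow> 'g set \<Rightarrow> ('g \<times> 'g) set" where
  "double_coset_rel G H K =
     {(g, g'). g \<in> carrier G \<and> g' \<in> carrier G \<and>
        (\<exists>h \<in> H. \<exists>k \<in> K. h \<otimes>\<^bsub>G\<^esub> g \<otimes>\<^bsub>G\<^esub> k = g')}"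

definition double_cosets :: "('g, 'm) monoid_scheme \<Rightarrow> 'g set \<Rightarrow> 'g set \<Rightarrow> 'g set set" where
  "double_cosets G H K = carrier G // double_coset_rel G H K"

text \<open>The letters of \<open>{H, K} \<union> X\<^sub>G\<close>: \<open>HSym\<close> and \<open>KSym\<close> are the two new symbols.\<close>

datatype 'x symbol = HSym | KSym | Gen (the_gen: 'x)

definition symbols :: "'x set \<Rightarrow> 'x symbol set" where
  "symbols X = {HSym, KSym} \<union> Gen ` X"

definition HK_word :: "'x list \<Rightarrow> 'x symbol list" where
  "HK_word w = HSym # map Gen w @ [KSym]"

definition HK_words :: "'x set \<Rightarrow> 'x symbol list set" where
  "HK_words X = HK_word ` lists X"

definition HK_inner :: "'x symbol list \<Rightarrow> 'x list" where
  "HK_inner t = map the_gen (butlast (tl t))"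

lemma HK_inner_HK_word [simp]: "HK_inner (HK_word w) = w"
  by (simp add: HK_inner_def HK_word_def comp_def)

definition double_coset_rules ::
    "'x rules \<Rightarrow> 'x list set \<Rightarrow> 'x list set \<Rightarrow> 'x symbol rules" where
  "double_coset_rules R X\<^sub>H X\<^sub>K =
     {(map Gen l, map Gen r) | l r. (l, r) \<in> R} \<union>
     {(HSym # map Gen h, [HSym]) | h. h \<in> X\<^sub>H} \<union>
     {(map Gen k @ [KSym], [KSym]) | k. k \<in> X\<^sub>K}"

datatype (rexp_atoms: 'a) rexp =
    Empty
  | Epsilon
  | Atom 'a
  | Alt "'a rexp" "'a rexp"
  | Conc "'a rexp" "'a rexp"
  | Star "'a rexp"

primrec rexp_lang :: "'a rexp \<Rightarrow> 'a list set" where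
  "rexp_lang Empty = {}"
| "rexp_lang Epsilon = {[]}"
| "rexp_lang (Atom a) = {[a]}"
| "rexp_lang (Alt r s) = rexp_lang r \<union> rexp_lang s"
| "rexp_lang (Conc r s) = {u @ v | u v. u \<in> rexp_lang r \<and> v \<in> rexp_lang s}"
| "rexp_lang (Star r) = {concat us | us. us \<in> lists (rexp_lang r)}"

end

theory Submission
  imports Defs "HOL-Library.Sublist"
begin

text \<open>The language \<open>L\<close> consists of the words \<open>H w K\<close> that are irreducible for \<open>R\<^sub>C\<close>. It is regular
  because \<open>R\<^sub>C\<close> is finite and every generator occurs in some rule (a letter occurring in no rule
  could never be cancelled against its inverse), so the alphabet is finite; irreducibility only
  means avoiding finitely many factors. A normal form of \<open>H w K\<close> has the shape \<open>a H w' K b\<close> with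
  \<open>\<theta>(a) = \<theta>(b) = \<one>\<close> and \<open>\<theta>(w') \<in> H \<theta>(w) K\<close>. Since \<open>a\<close> and \<open>b\<close> are irreducible and congruent to
  the empty word, which is irreducible by termination, both are empty. So every double coset has a
  representative in \<open>L\<close>, and it is unique because words of the same double coset are congruent.\<close>


section \<open>Languages with finitely many left quotients are regular\<close>

text \<open>The bound on the atoms is carried through every closure lemma because the final
  expression may use only letters of the given alphabet.\<close>

definition regular_over :: "'a set \<Rightarrow> 'a list set \<Rightarrow> bool" where
  "regular_over A L \<longleftrightarrow> (\<exists>e. rexp_atoms e \<subseteq> A \<and> rexp_lang e = L)"

lemma regular_over_empty [simp]: "regular_over A {}"
  unfolding regular_over_def by (rule exI[of _ Empty]) simp

lemma regular_over_Un:
  assumes "regular_over A L" "regular_over A M"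
  shows "regular_over A (L \<union> M)"
proof -
  obtain e f where "rexp_atoms e \<subseteq> A" "rexp_lang e = L" "rexp_atoms f \<subseteq> A" "rexp_lang f = M"
    using assms unfolding regular_over_def by blast
  then show ?thesis
    unfolding regular_over_def by (intro exI[of _ "Alt e f"]) simp
qed

lemma regular_over_conc:
  assumes "regular_over A L" "regular_over A M"
  shows "regular_over A {u @ v | u v. u \<in> L \<and> v \<in> M}"
proof -
  obtain e f where "rexp_atoms e \<subseteq> A" "rexp_lang e = L" "rexp_atoms f \<subseteq> A" "rexp_lang f = M"
    using assms unfolding regular_over_def by blast
  then show ?thesis
    unfolding regular_over_def by (intro exI[of _ "Conc e f"]) simp
qed

lemma regular_over_star:
  assumes "regular_over A L"
  shows "regular_over A {concat us | us. us \<in> lists L}"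
proof -
  obtain e where "rexp_atoms e \<subseteq> A" "rexp_lang e = L"
    using assms unfolding regular_over_def by blast
  then show ?thesis
    unfolding regular_over_def by (intro exI[of _ "Star e"]) simp
qed

lemma regular_over_UN:
  "finite I \<Longrightarrow> (\<And>i. i \<in> I \<Longrightarrow> regular_over A (L i)) \<Longrightarrow> regular_over A (\<Union>i\<in>I. L i)"
  by (induction I rule: finite_induct) (auto intro: regular_over_Un)

lemma regular_over_word: "w \<in> lists A \<Longrightarrow> regular_over A {w}"
proof (induction w)
  case Nil
  show ?case unfolding regular_over_def by (rule exI[of _ Epsilon]) simp
next
  case (Cons a w)
  have "regular_over A {[a]}"
    unfolding regular_over_def using Cons.prems by (intro exI[of _ "Atom a"]) simp
  from regular_over_conc[OF this Cons.IH] Cons.prems show ?case by simp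
qed

lemma regular_over_finite: "finite L \<Longrightarrow> L \<subseteq> lists A \<Longrightarrow> regular_over A L"
  using regular_over_UN[of L A "\<lambda>w. {w}"] regular_over_word[of _ A] by (simp add: subset_iff)

text \<open>Runs of the deterministic automaton \<open>d\<close> all of whose strictly intermediate states lie
  in \<open>S\<close>; neither the first nor the last state has to lie in \<open>S\<close>.\<close>

primrec run_via :: "('q \<Rightarrow> 'a \<Rightarrow> 'q) \<Rightarrow> 'q set \<Rightarrow> 'q \<Rightarrow> 'q \<Rightarrow> 'a list \<Rightarrow> bool" where
  "run_via d S p q [] \<longleftrightarrow> p = q"
| "run_via d S p q (a # w) \<longleftrightarrow> (w = [] \<or> d p a \<in> S) \<and> run_via d S (d p a) q w"

lemma run_via_append:
  "run_via d S p k u \<Longrightarrow> run_via d S k q v \<Longrightarrow> k \<in> S \<Longrightarrow> run_via d S p q (u @ v)"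
  by (induction u arbitrary: p) auto

lemma run_via_mono: "run_via d S p q w \<Longrightarrow> S \<subseteq> S' \<Longrightarrow> run_via d S' p q w"
  by (induction w arbitrary: p) auto

text \<open>Cut the run at its first intermediate state outside \<open>S\<close>, which can only be
  \<open>k\<close>. The starting state is not intermediate, so the piece cut off is nonempty even if
  \<open>p = k\<close>.\<close>

lemma run_via_insert_first:
  "run_via d (insert k S) p q w \<Longrightarrow> run_via d S p q w \<or>
     (\<exists>u v. w = u @ v \<and> u \<noteq> [] \<and> run_via d S p k u \<and> run_via d (insert k S) k q v)"
proof (induction w arbitrary: p)
  case Nil
  then show ?case by simp
next
  case (Cons a w)
  show ?case
  proof (cases "w = [] \<or> d p a \<in> S")
    case False
    then show ?thesis
      using Cons.prems by (intro disjI2 exI[of _ "[a]"] exI[of _ w]) auto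
  next
    case S: True
    have run: "run_via d (insert k S) (d p a) q w"
      using Cons.prems by simp
    from Cons.IH[OF run] show ?thesis
    proof
      assume "run_via d S (d p a) q w"
      then show ?thesis using S by simp
    next
      assume "\<exists>u v. w = u @ v \<and> u \<noteq> [] \<and> run_via d S (d p a) k u \<and> run_via d (insert k S) k q v"
      then obtain u v where "w = u @ v" "u \<noteq> []" "run_via d S (d p a) k u"
        "run_via d (insert k S) k q v"
        by blast
      then show ?thesis using S by (intro disjI2 exI[of _ "a # u"] exI[of _ v]) simp
    qed
  qed
qed

text \<open>Repeated cutting peels off loops at \<open>k\<close>. Each loop is nonempty, so the
  remaining word gets shorter and the process ends.\<close>

lemma run_via_insert_loops:
  "run_via d (insert k S) k q w \<Longrightarrow>
     \<exists>us v. w = concat us @ v \<and> (\<forall>u\<in>set us. run_via d S k k u) \<and> run_via d S k q v"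
proof (induction w rule: length_induct)
  case (1 w)
  from run_via_insert_first[OF 1(2)] show ?case
  proof
    assume "run_via d S k q w"
    then show ?thesis by (intro exI[of _ "[]"] exI[of _ w]) simp
  next
    assume "\<exists>u v. w = u @ v \<and> u \<noteq> [] \<and> run_via d S k k u \<and> run_via d (insert k S) k q v"
    then obtain u v where w: "w = u @ v" "u \<noteq> []" "run_via d S k k u"
      and v: "run_via d (insert k S) k q v"
      by blast
    have "length v < length w" using w by simp
    with 1(1) v obtain us v' where
      "v = concat us @ v'" "\<forall>u\<in>set us. run_via d S k k u" "run_via d S k q v'"
      by blast
    with w show ?thesis by (intro exI[of _ "u # us"] exI[of _ v']) simp
  qed
qed

lemma run_via_concat:
  "\<forall>u\<in>set us. run_via d S k k u \<Longrightarrow> k \<in> S \<Longrightarrow> run_via d S k k (concat us)"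
  by (induction us) (auto intro: run_via_append)

text \<open>Kleene's recursion \<open>L_pq + L_pk L_kk* L_kq\<close> for a newly permitted state
  \<open>k\<close>, with all languages restricted to words over \<open>A\<close>.\<close>

lemma run_via_insert:
  "{w \<in> lists A. run_via d (insert k S) p q w} =
     {w \<in> lists A. run_via d S p q w} \<union>
     {u @ v | u v. u \<in> {w \<in> lists A. run_via d S p k w} \<and>
        v \<in> {u @ v | u v. u \<in> {concat us | us. us \<in> lists {w \<in> lists A. run_via d S k k w}} \<and>
               v \<in> {w \<in> lists A. run_via d S k q w}}}"
  (is "?L = ?R")
proof
  show "?L \<subseteq> ?R"
  proof
    fix w assume "w \<in> ?L"
    then have A: "w \<in> lists A" and run: "run_via d (insert k S) p q w" by auto
    show "w \<in> ?R"
    proof (cases "run_via d S p q w")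
      case False
      then obtain u v where w: "w = u @ v" "run_via d S p k u" "run_via d (insert k S) k q v"
        using run_via_insert_first[OF run] by blast
      obtain us v' where v: "v = concat us @ v'" "\<forall>u\<in>set us. run_via d S k k u"
        "run_via d S k q v'"
        using run_via_insert_loops[OF w(3)] by blast
      have "us \<in> lists {w \<in> lists A. run_via d S k k w}"
        using A w v by auto
      moreover have "u \<in> lists A" "v' \<in> lists A"
        using A w v by auto
      ultimately show ?thesis using w v by blast
    qed (use A in simp)
  qed
  show "?R \<subseteq> ?L"
  proof
    fix w assume "w \<in> ?R"
    then consider "w \<in> lists A" "run_via d S p q w"
      | u us v where "w = u @ concat us @ v" "u \<in> lists A" "run_via d S p k u"
          "us \<in> lists {w \<in> lists A. run_via d S k k w}" "v \<in> lists A" "run_via d S k q v"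
      by blast
    then show "w \<in> ?L"
    proof cases
      case 1
      then show ?thesis by (auto intro: run_via_mono)
    next
      case 2
      have mono: "run_via d S a b x \<Longrightarrow> run_via d (insert k S) a b x" for a b x
        by (rule run_via_mono) auto
      have "run_via d (insert k S) k k (concat us)"
        using 2(4) by (intro run_via_concat) (auto intro: mono)
      then have "run_via d (insert k S) p q w"
        unfolding 2(1) using mono[OF 2(3)] mono[OF 2(6)]
        by (blast intro: run_via_append)
      moreover have "w \<in> lists A" using 2(1,2,4,5) by fastforce
      ultimately show ?thesis by simp
    qed
  qed
qed

text \<open>Induction on the permitted intermediate states: Kleene's recursion adds one state using
  only union, concatenation and star. The endpoints vary because the recursion refers to runs from
  and to \<open>k\<close>.\<close>

lemma regular_over_run_via:
  assumes "finite A" "finite S"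
  shows "regular_over A {w \<in> lists A. run_via d S p q w}"
  using \<open>finite S\<close>
proof (induction S arbitrary: p q rule: finite_induct)
  case empty
  \<comment> \<open>Without intermediate states a run reads at most one letter.\<close>
  have "{w \<in> lists A. run_via d {} p q w} \<subseteq> {[]} \<union> (\<lambda>a. [a]) ` A"
  proof
    fix w assume "w \<in> {w \<in> lists A. run_via d {} p q w}"
    then show "w \<in> {[]} \<union> (\<lambda>a. [a]) ` A" by (cases w) auto
  qed
  then show ?case
    using \<open>finite A\<close> by (intro regular_over_finite) (auto intro: finite_subset)
next
  case (insert k S)
  show ?case
    unfolding run_via_insert
    by (intro regular_over_Un regular_over_conc regular_over_star insert.IH)
qed

lemma run_via_closed:
  "(\<And>p a. p \<in> Q \<Longrightarrow> a \<in> A \<Longrightarrow> d p a \<in> Q) \<Longrightarrow> p \<in> Q \<Longrightarrow> w \<in> lists A \<Longrightarrow>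
     run_via d Q p q w \<longleftrightarrow> foldl d p w = q"
  by (induction w arbitrary: p) auto

text \<open>The residual of \<open>L\<close> by \<open>w\<close> from the Myhill-Nerode theorem: as
  an automaton state it records what may still follow \<open>w\<close>.\<close>

definition left_quotient :: "'a list \<Rightarrow> 'a list set \<Rightarrow> 'a list set" where
  "left_quotient w L = {v. w @ v \<in> L}"

lemma foldl_left_quotient: "foldl (\<lambda>M a. left_quotient [a] M) L w = left_quotient w L"
  by (induction w arbitrary: L) (auto simp: left_quotient_def)

text \<open>One half of Myhill-Nerode: the left quotients are the states of a deterministic
  automaton with initial state \<open>L\<close>, where a state accepts iff it contains the empty
  word.\<close>

theorem regular_over_finite_quotients:
  assumes "finite A" "L \<subseteq> lists A" and fin: "finite ((\<lambda>w. left_quotient w L) ` lists A)"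
  shows "regular_over A L"
proof -
  let ?Q = "(\<lambda>w. left_quotient w L) ` lists A"
  let ?d = "\<lambda>M a. left_quotient [a] M"
  have "?d p a \<in> ?Q" if "p \<in> ?Q" "a \<in> A" for p a
  proof -
    from that obtain w where w: "w \<in> lists A" "p = left_quotient w L" by auto
    then have "?d p a = left_quotient (w @ [a]) L" by (simp add: left_quotient_def)
    then show ?thesis using w \<open>a \<in> A\<close> by (intro image_eqI[of _ _ "w @ [a]"]) auto
  qed
  moreover have "L \<in> ?Q"
    by (rule image_eqI[of _ _ "[]"]) (auto simp: left_quotient_def)
  \<comment> \<open>Transitions stay in \<open>?Q\<close>, so a run via \<open>?Q\<close> is an
    ordinary run, and it ends in the quotient by the word read.\<close>
  ultimately have run: "run_via ?d ?Q L q w \<longleftrightarrow> left_quotient w L = q" if "w \<in> lists A" for w q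
    using that run_via_closed[of ?Q A ?d L w q] foldl_left_quotient[of L w] by blast
  have "L = (\<Union>M \<in> {M \<in> ?Q. [] \<in> M}. {w \<in> lists A. run_via ?d ?Q L M w})"
  proof (rule Set.set_eqI)
    fix w
    show "w \<in> L \<longleftrightarrow>
        w \<in> (\<Union>M \<in> {M \<in> ?Q. [] \<in> M}. {w \<in> lists A. run_via ?d ?Q L M w})"
    proof (cases "w \<in> lists A")
      case True
      have "[] \<in> left_quotient w L \<longleftrightarrow> w \<in> L" by (simp add: left_quotient_def)
      then show ?thesis using True run[OF True] by blast
    qed (use \<open>L \<subseteq> lists A\<close> in blast)
  qed
  moreover have "regular_over A (\<Union>M \<in> {M \<in> ?Q. [] \<in> M}. {w \<in> lists A. run_via ?d ?Q L M w})"
    using assms(1) fin by (intro regular_over_UN regular_over_run_via) auto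
  ultimately show ?thesis by simp
qed

text \<open>Quotients commute with intersection, so a quotient of \<open>L \<inter> M\<close> is
  determined by a pair of quotients, as in a product automaton.\<close>

lemma finite_quotients_Int:
  assumes "finite ((\<lambda>w. left_quotient w L) ` B)" "finite ((\<lambda>w. left_quotient w M) ` B)"
  shows "finite ((\<lambda>w. left_quotient w (L \<inter> M)) ` B)"
proof (rule finite_subset)
  let ?I = "(\<lambda>w. left_quotient w L) ` B" and ?J = "(\<lambda>w. left_quotient w M) ` B"
  show "(\<lambda>w. left_quotient w (L \<inter> M)) ` B \<subseteq> (\<lambda>(P, Q). P \<inter> Q) ` (?I \<times> ?J)"
  proof
    fix P assume "P \<in> (\<lambda>w. left_quotient w (L \<inter> M)) ` B"
    then obtain w where "w \<in> B" "P = left_quotient w L \<inter> left_quotient w M"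
      by (auto simp: left_quotient_def)
    then show "P \<in> (\<lambda>(P, Q). P \<inter> Q) ` (?I \<times> ?J)" by blast
  qed
  show "finite ((\<lambda>(P, Q). P \<inter> Q) ` (?I \<times> ?J))"
    using assms by blast
qed

section \<open>Words avoiding finitely many factors\<close>

definition avoids :: "'a list set \<Rightarrow> 'a list \<Rightarrow> bool" where
  "avoids F w \<longleftrightarrow> (\<forall>l\<in>F. \<not> sublist l w)"

lemma avoids_sublist: "avoids F w \<Longrightarrow> sublist u w \<Longrightarrow> avoids F u"
  unfolding avoids_def by (blast intro: sublist_order.order_trans)

text \<open>As \<open>w\<close> avoids \<open>F\<close>, a forbidden factor of \<open>w @ v\<close>
  must use letters of \<open>v\<close>, so it reaches back at most \<open>n\<close> letters into
  \<open>w\<close>. Truncated subtraction keeps all of \<open>w\<close> if it is shorter than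
  \<open>n\<close>.\<close>

lemma avoids_append_window:
  assumes w: "avoids F w" and len: "\<And>l. l \<in> F \<Longrightarrow> length l \<le> n"
  shows "avoids F (w @ v) \<longleftrightarrow> avoids F (drop (length w - n) w @ v)"
proof
  assume "avoids F (w @ v)"
  moreover have "sublist (drop (length w - n) w @ v) (w @ v)"
    unfolding sublist_def
    by (intro exI[of _ "take (length w - n) w"] exI[of _ "[]"])
       (simp add: append_assoc[symmetric] del: append_assoc)
  ultimately show "avoids F (drop (length w - n) w @ v)" by (rule avoids_sublist)
next
  assume s: "avoids F (drop (length w - n) w @ v)"
  have "\<not> sublist l (w @ v)" if l: "l \<in> F" for l
  proof
    assume "sublist l (w @ v)"
    moreover have "\<not> sublist l w" using w l by (auto simp: avoids_def)
    moreover have "\<not> sublist l (drop (length w - n) w @ v)" using s l by (auto simp: avoids_def)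
    \<comment> \<open>The occurrence straddles the boundary: \<open>a\<close> ends \<open>w\<close>
      and \<open>b\<close> begins \<open>v\<close>.\<close>
    ultimately obtain a b where ab: "l = a @ b" "suffix a w" "prefix b v"
      and nl: "\<not> sublist l (drop (length w - n) w @ v)"
      by (auto simp: sublist_append)
    have "length a \<le> n" using len[OF l] ab by simp
    moreover obtain c where "w = c @ a"
      using ab(2) by (auto simp: suffix_def)
    ultimately have "suffix a (drop (length w - n) w)"
      by (simp add: suffix_def)
    with ab nl show False by (auto simp: sublist_append)
  qed
  then show "avoids F (w @ v)" by (simp add: avoids_def)
qed

text \<open>A word with a forbidden factor has the empty quotient. Otherwise the quotient depends
  only on the last \<open>n\<close> letters, and a finite alphabet admits finitely many such
  windows.\<close>

lemma finite_quotients_avoids: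
  assumes "finite A" "finite F"
  shows "finite ((\<lambda>w. left_quotient w (Collect (avoids F))) ` lists A)"
proof (rule finite_subset)
  \<comment> \<open>The \<open>0\<close> makes the maximum meaningful for empty
    \<open>F\<close>.\<close>
  define n where "n = Max (insert 0 (length ` F))"
  let ?S = "{s. set s \<subseteq> A \<and> length s \<le> n}"
  have len: "length l \<le> n" if "l \<in> F" for l
    unfolding n_def using that assms(2) by simp
  show "(\<lambda>w. left_quotient w (Collect (avoids F))) ` lists A
      \<subseteq> insert {} ((\<lambda>s. left_quotient s (Collect (avoids F))) ` ?S)"
  proof
    fix P assume "P \<in> (\<lambda>w. left_quotient w (Collect (avoids F))) ` lists A"
    then obtain w where w: "w \<in> lists A" "P = left_quotient w (Collect (avoids F))" by blast
    show "P \<in> insert {} ((\<lambda>s. left_quotient s (Collect (avoids F))) ` ?S)"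
    proof (cases "avoids F w")
      case True
      then have "P = left_quotient (drop (length w - n) w) (Collect (avoids F))"
        using avoids_append_window[OF True len] w(2) by (auto simp: left_quotient_def)
      moreover have "drop (length w - n) w \<in> ?S"
        using w(1) by (auto dest: in_set_dropD)
      ultimately show ?thesis by blast
    next
      case False
      then have "P = {}"
        using w(2) by (auto simp: left_quotient_def dest: avoids_sublist)
      then show ?thesis by simp
    qed
  qed
  show "finite (insert {} ((\<lambda>s. left_quotient s (Collect (avoids F))) ` ?S))"
    using finite_lists_length_le[OF assms(1)] by simp
qed

section \<open>Congruences and normal forms\<close>

lemma rewrite_step_in_lists:
  assumes "is_rewriting_system A R" "rewrite_step A R s t"
  shows "s \<in> lists A" "t \<in> lists A"
  using assms(2,1) by (cases; auto simp: is_rewriting_system_def simp del: in_lists_conv_set)+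

lemma generated_congruence_in_lists:
  "(u, v) \<in> generated_congruence A R \<Longrightarrow> u \<in> lists A \<and> v \<in> lists A"
  by (simp add: generated_congruence_def)

lemma equivclp_in_lists:
  "equivclp (rewrite_step A R) u v \<Longrightarrow> is_rewriting_system A R \<Longrightarrow> u \<in> lists A \<Longrightarrow> v \<in> lists A"
  by (induction rule: equivclp_induct) (blast dest: rewrite_step_in_lists)+

lemma generated_congruence_iff:
  assumes "is_rewriting_system A R"
  shows "(u, v) \<in> generated_congruence A R \<longleftrightarrow> u \<in> lists A \<and> equivclp (rewrite_step A R) u v"
  using equivclp_in_lists[OF _ assms] by (auto simp: generated_congruence_def)

lemma equiv_generated_congruence: "equiv (lists A) (generated_congruence A R)"
  unfolding generated_congruence_def
  by (intro equivI refl_onI symI transI) (auto intro: equivclp_sym equivclp_trans)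

lemma generated_congruence_refl: "u \<in> lists A \<Longrightarrow> (u, u) \<in> generated_congruence A R"
  by (simp add: generated_congruence_def)

lemma generated_congruence_sym:
  "(u, v) \<in> generated_congruence A R \<Longrightarrow> (v, u) \<in> generated_congruence A R"
  by (auto simp: generated_congruence_def intro: equivclp_sym)

lemma generated_congruence_trans [trans]:
  "(u, v) \<in> generated_congruence A R \<Longrightarrow> (v, w) \<in> generated_congruence A R \<Longrightarrow>
     (u, w) \<in> generated_congruence A R"
  by (auto simp: generated_congruence_def intro: equivclp_trans)

lemma generated_congruence_rule:
  assumes "is_rewriting_system A R" "(l, r) \<in> R"
  shows "(l, r) \<in> generated_congruence A R"
proof -
  have "rewrite_step A R ([] @ l @ []) ([] @ r @ [])"
    using assms by (intro rewrite_step.intros) auto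
  then show ?thesis
    using rewrite_step_in_lists[OF assms(1)] by (auto simp: generated_congruence_def)
qed

lemma rewrite_step_context:
  assumes "rewrite_step A R s t" "a \<in> lists A" "b \<in> lists A"
  shows "rewrite_step A R (a @ s @ b) (a @ t @ b)"
  using assms(1)
proof cases
  case (1 l r u v)
  then have "rewrite_step A R ((a @ u) @ l @ (v @ b)) ((a @ u) @ r @ (v @ b))"
    using assms by (intro rewrite_step.intros) auto
  then show ?thesis using 1 by simp
qed

lemma equivclp_map:
  "equivclp r x y \<Longrightarrow> (\<And>x y. r x y \<Longrightarrow> equivclp q (f x) (f y)) \<Longrightarrow> equivclp q (f x) (f y)"
  by (induction rule: equivclp_induct) (blast intro: equivclp_trans equivclp_sym equivclp_refl)+

lemma generated_congruence_context:
  assumes "(s, t) \<in> generated_congruence A R" "a \<in> lists A" "b \<in> lists A"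
  shows "(a @ s @ b, a @ t @ b) \<in> generated_congruence A R"
proof -
  have "equivclp (rewrite_step A R) (a @ s @ b) (a @ t @ b)"
    by (rule equivclp_map[where f = "\<lambda>s. a @ s @ b" and r = "rewrite_step A R"])
       (use assms(1) in \<open>auto simp: generated_congruence_def
          intro: r_into_equivclp rewrite_step_context[OF _ assms(2,3)]\<close>)
  then show ?thesis using assms by (auto simp: generated_congruence_def)
qed

lemma generated_congruence_append:
  assumes "(s, s') \<in> generated_congruence A R" "(t, t') \<in> generated_congruence A R"
  shows "(s @ t, s' @ t') \<in> generated_congruence A R"
proof -
  note A = generated_congruence_in_lists[OF assms(1)] generated_congruence_in_lists[OF assms(2)]
  have "([] @ s @ t, [] @ s' @ t) \<in> generated_congruence A R"
    using assms(1) A by (intro generated_congruence_context) auto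
  moreover have "(s' @ t @ [], s' @ t' @ []) \<in> generated_congruence A R"
    using assms(2) A by (intro generated_congruence_context) auto
  ultimately show ?thesis by (auto intro: generated_congruence_trans)
qed

text \<open>Used below for the final state of an automaton and for the occurrences of one letter.
  Each step of the equivalence closure, in either direction, keeps the value of
  \<open>f\<close>.\<close>

lemma generated_congruence_invariant:
  assumes "(s, t) \<in> generated_congruence A R"
    and "\<And>u l r v. (l, r) \<in> R \<Longrightarrow> u \<in> lists A \<Longrightarrow> v \<in> lists A \<Longrightarrow> f (u @ l @ v) = f (u @ r @ v)"
  shows "f s = f t"
proof -
  have step: "rewrite_step A R s t \<Longrightarrow> f s = f t" for s t
    by (auto elim!: rewrite_step.cases assms(2))
  have "equivclp (rewrite_step A R) s t"
    using assms(1) by (simp add: generated_congruence_def)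
  then show ?thesis
    by (induction rule: equivclp_induct) (auto dest: step)
qed

text \<open>This turns irreducibility into avoidance of left-hand sides, the form needed for
  regularity. The context of a factor of \<open>w\<close> lies over \<open>A\<close> because
  \<open>w\<close> does.\<close>

lemma rewrite_step_iff_not_avoids:
  assumes "is_rewriting_system A R" "w \<in> lists A"
  shows "(\<exists>t. rewrite_step A R w t) \<longleftrightarrow> \<not> avoids (fst ` R) w"
proof
  assume "\<exists>t. rewrite_step A R w t"
  then show "\<not> avoids (fst ` R) w"
    by (force simp: avoids_def elim!: rewrite_step.cases)
next
  assume "\<not> avoids (fst ` R) w"
  then obtain l r u v where lr: "(l, r) \<in> R" and w: "w = u @ l @ v"
    by (auto simp: avoids_def sublist_def)
  then have "rewrite_step A R w (u @ r @ v)"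
    unfolding w using lr assms(2)[unfolded w] by (intro rewrite_step.intros) auto
  then show "\<exists>t. rewrite_step A R w t" ..
qed

text \<open>Well-founded induction along the rewrite steps: a word that contains a left-hand side
  has a successor, and the successor has a normal form.\<close>

lemma normal_form_exists:
  assumes "complete_rewriting_system A R" "w \<in> lists A"
  obtains t where "(w, t) \<in> generated_congruence A R" "avoids (fst ` R) t"
proof -
  have sys: "is_rewriting_system A R" and wf: "wfp ((rewrite_step A R)\<inverse>\<inverse>)"
    using assms(1) by (auto simp: complete_rewriting_system_def)
  have "\<exists>t. (w, t) \<in> generated_congruence A R \<and> avoids (fst ` R) t"
    using wf assms(2)
  proof (induction w rule: wfp_induct_rule)
    case (less w)
    show ?case
    proof (cases "avoids (fst ` R) w")
      case True
      then show ?thesis using generated_congruence_refl[OF less.prems] by blast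
    next
      case False
      then obtain s where s: "rewrite_step A R w s"
        using rewrite_step_iff_not_avoids[OF sys less.prems] by blast
      then have "(w, s) \<in> generated_congruence A R"
        using less.prems by (auto simp: generated_congruence_iff[OF sys])
      then show ?thesis
        using less.IH[of s] s rewrite_step_in_lists[OF sys s]
        by (auto intro: generated_congruence_trans)
    qed
  qed
  then show ?thesis using that by blast
qed

text \<open>By confluence (Church-Rosser) congruent words have a common reduct, and an irreducible
  word reduces only to itself.\<close>

lemma normal_form_unique:
  assumes R: "complete_rewriting_system A R" and st: "(s, t) \<in> generated_congruence A R"
    and "avoids (fst ` R) s" "avoids (fst ` R) t"
  shows "s = t"
proof -
  have sys: "is_rewriting_system A R" and conf: "confluentp (rewrite_step A R)"
    using R by (auto simp: complete_rewriting_system_def)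
  have "equivclp (rewrite_step A R) s t"
    using st by (simp add: generated_congruence_def)
  then obtain z where z: "(rewrite_step A R)\<^sup>*\<^sup>* s z" "(rewrite_step A R)\<^sup>*\<^sup>* t z"
    unfolding semiconfluentp_equivclp[OF confluentp_imp_semiconfluentp[OF conf]]
    by (auto simp: rtranclp_conversep)
  have "\<not> rewrite_step A R s y" "\<not> rewrite_step A R t y" for y
    using rewrite_step_iff_not_avoids[OF sys] assms(3,4) generated_congruence_in_lists[OF st]
    by blast+
  then show ?thesis
    using z by (metis converse_rtranclpE)
qed

text \<open>The empty word is a factor of the irreducible word \<open>a\<close>, so it is
  irreducible too and uniqueness applies.\<close>

lemma normal_form_Nil:
  assumes R: "complete_rewriting_system A R" and a: "avoids (fst ` R) a"
    and "(a, []) \<in> generated_congruence A R"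
  shows "a = []"
  using avoids_sublist[OF a, of "[]"] normal_form_unique[OF R assms(3) a] by simp


section \<open>Group presentations\<close>

locale presented_group = group G for G (structure) +
  fixes X :: "'x set" and R :: "'x rules" and \<theta> :: "'x list \<Rightarrow> 'a"
  assumes presentation: "group_presentation G X R \<theta>"
begin

lemma rewriting_system: "is_rewriting_system X R"
  using presentation by (simp add: group_presentation_def)

lemma theta_factors:
  obtains \<phi> where "\<phi> \<in> iso (presented_monoid X R) G"
    "\<And>w. w \<in> lists X \<Longrightarrow> \<theta> w = \<phi> (generated_congruence X R `` {w})"
  using presentation by (auto simp: group_presentation_def)

text \<open>The isomorphism \<open>\<phi>\<close> is injective on congruence classes, and two words
  have the same class exactly if they are congruent.\<close>

lemma theta_eq_iff:
  assumes "u \<in> lists X" "v \<in> lists X"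
  shows "\<theta> u = \<theta> v \<longleftrightarrow> (u, v) \<in> generated_congruence X R"
proof -
  let ?C = "generated_congruence X R"
  obtain \<phi> where \<phi>: "\<phi> \<in> iso (presented_monoid X R) G" "\<And>w. w \<in> lists X \<Longrightarrow> \<theta> w = \<phi> (?C `` {w})"
    using theta_factors by blast
  have inj: "inj_on \<phi> (lists X // ?C)"
    using \<phi>(1) by (simp add: iso_def bij_betw_def presented_monoid_def)
  have "\<theta> u = \<theta> v \<longleftrightarrow> ?C `` {u} = ?C `` {v}"
    using assms \<phi>(2) inj_on_eq_iff[OF inj quotientI quotientI] by simp
  then show ?thesis
    using eq_equiv_class_iff[OF equiv_generated_congruence assms] by simp
qed

lemma theta_surj:
  assumes "g \<in> carrier G"
  obtains w where "w \<in> lists X" "\<theta> w = g"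
proof -
  let ?C = "generated_congruence X R"
  obtain \<phi> where \<phi>: "\<phi> \<in> iso (presented_monoid X R) G" "\<And>w. w \<in> lists X \<Longrightarrow> \<theta> w = \<phi> (?C `` {w})"
    using theta_factors by blast
  have "\<phi> ` (lists X // ?C) = carrier G"
    using \<phi>(1) by (simp add: iso_def bij_betw_def presented_monoid_def)
  then have "g \<in> \<phi> ` (lists X // ?C)"
    using assms by simp
  then obtain U where U: "U \<in> lists X // ?C" "\<phi> U = g"
    by (elim imageE) simp
  from U(1) obtain w where "w \<in> lists X" "U = ?C `` {w}"
    by (rule quotientE)
  then show ?thesis
    using that \<phi>(2) U(2) by simp
qed

lemma theta_closed [simp]:
  assumes "w \<in> lists X"
  shows "\<theta> w \<in> carrier G"
proof -
  let ?C = "generated_congruence X R"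
  obtain \<phi> where \<phi>: "\<phi> \<in> iso (presented_monoid X R) G" "\<And>w. w \<in> lists X \<Longrightarrow> \<theta> w = \<phi> (?C `` {w})"
    using theta_factors by blast
  have "\<phi> ` (lists X // ?C) = carrier G"
    using \<phi>(1) by (simp add: iso_def bij_betw_def presented_monoid_def)
  then show ?thesis
    using \<phi>(2)[OF assms] quotientI[OF assms, of ?C] by auto
qed

lemma theta_append:
  assumes "u \<in> lists X" "v \<in> lists X"
  shows "\<theta> (u @ v) = \<theta> u \<otimes> \<theta> v"
proof -
  let ?C = "generated_congruence X R"
  obtain \<phi> where \<phi>: "\<phi> \<in> iso (presented_monoid X R) G" "\<And>w. w \<in> lists X \<Longrightarrow> \<theta> w = \<phi> (?C `` {w})"
    using theta_factors by blast
  have "\<phi> (?C `` {x @ y | x y. x \<in> U \<and> y \<in> V}) = \<phi> U \<otimes> \<phi> V"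
    if "U \<in> lists X // ?C" "V \<in> lists X // ?C" for U V
    using \<phi>(1) that by (simp add: iso_def hom_def presented_monoid_def)
  from this[OF quotientI[OF assms(1)] quotientI[OF assms(2)]]
  have "\<phi> (?C `` {x @ y | x y. x \<in> ?C `` {u} \<and> y \<in> ?C `` {v}}) = \<phi> (?C `` {u}) \<otimes> \<phi> (?C `` {v})" .
  \<comment> \<open>The product of two classes in \<open>presented_monoid\<close> is the saturation
    of their elementwise concatenation. As the congruence respects concatenation, it is a single
    class.\<close>
  moreover have "?C `` {x @ y | x y. x \<in> ?C `` {u} \<and> y \<in> ?C `` {v}} = ?C `` {u @ v}"
  proof
    show "?C `` {u @ v} \<subseteq> ?C `` {x @ y | x y. x \<in> ?C `` {u} \<and> y \<in> ?C `` {v}}"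
      using assms by (blast intro: generated_congruence_refl)
    show "?C `` {x @ y | x y. x \<in> ?C `` {u} \<and> y \<in> ?C `` {v}} \<subseteq> ?C `` {u @ v}"
      by (blast intro: generated_congruence_trans generated_congruence_append)
  qed
  moreover have "u @ v \<in> lists X"
    using assms by simp
  ultimately show ?thesis
    using assms \<phi>(2) by simp
qed

text \<open>The value of the empty word is idempotent, and a group has only one idempotent.\<close>

lemma theta_Nil [simp]: "\<theta> [] = \<one>"
  using theta_append[of "[]" "[]"] theta_closed[of "[]"] by simp

lemma theta_Cons: "x \<in> X \<Longrightarrow> w \<in> lists X \<Longrightarrow> \<theta> (x # w) = \<theta> [x] \<otimes> \<theta> w"
  using theta_append[of "[x]" w] by simp

end

section \<open>Congruence classes of double coset words\<close>

text \<open>\<open>Before\<close> holds the value of the generators read so far.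
  \<open>Inside\<close> holds a right coset instead of an element, so that reading words of
  \<open>X\<^sub>H\<close> right after \<open>HSym\<close> changes nothing. \<open>After\<close>
  holds the double coset and the value of the tail, and \<open>Stuck\<close> is a sink.\<close>

datatype 'g state = Before 'g | Inside "'g set" | After "'g set" 'g | Stuck

locale double_coset_presentation = presented_group +
  fixes X\<^sub>H X\<^sub>K :: "'b list set"
  assumes XH: "X\<^sub>H \<subseteq> lists X" and XK: "X\<^sub>K \<subseteq> lists X"
begin

abbreviation "H \<equiv> generate G (\<theta> ` X\<^sub>H)"
abbreviation "K \<equiv> generate G (\<theta> ` X\<^sub>K)"
abbreviation "\<Sigma> \<equiv> symbols X"
abbreviation "R\<^sub>D \<equiv> double_coset_rules R X\<^sub>H X\<^sub>K"
abbreviation "C\<^sub>D \<equiv> generated_congruence \<Sigma> R\<^sub>D"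

lemma subgroup_H: "subgroup H G" and subgroup_K: "subgroup K G"
  by (rule generate_is_subgroup, use XH XK in \<open>blast intro: theta_closed\<close>)+

lemma H_subset: "H \<subseteq> carrier G" and K_subset: "K \<subseteq> carrier G"
  using subgroup_H subgroup_K by (auto dest: subgroup.subset)

lemma map_Gen_in_lists [simp]: "map Gen w \<in> lists \<Sigma> \<longleftrightarrow> w \<in> lists X"
  by (auto simp: symbols_def)

lemma rewriting_system_double_coset: "is_rewriting_system \<Sigma> R\<^sub>D"
proof -
  have "[HSym] \<in> lists \<Sigma>" "[KSym] \<in> lists \<Sigma>" by (auto simp: symbols_def)
  then show ?thesis
    using rewriting_system XH XK
    unfolding is_rewriting_system_def double_coset_rules_def subset_iff
    by (auto simp del: lists_image del: in_listsD in_listsI)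
qed

section \<open>An automaton invariant of the congruence\<close>

fun translate :: "'a state \<Rightarrow> 'a \<Rightarrow> 'a state" where
  "translate (Before a) g = Before (a \<otimes> g)"
| "translate (Inside C) g = Inside (C #> g)"
| "translate (After D b) g = After D (b \<otimes> g)"
| "translate Stuck g = Stuck"

text \<open>Reading \<open>a H w K b\<close> from \<open>Before \<one>\<close> leads to \<open>After (H \<theta>(w) K) (\<theta>(b))\<close> if \<open>\<theta>(a) = \<one>\<close>, and
  words of any other shape never reach an \<open>After\<close> state. All rules of \<open>R\<^sub>D\<close> preserve the final
  state, so it is an invariant of the congruence.\<close>

fun act :: "'a state \<Rightarrow> 'b symbol \<Rightarrow> 'a state" where
  "act s (Gen x) = translate s (\<theta> [x])"
| "act (Before a) HSym = (if a = \<one> then Inside H else Stuck)"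
| "act (Inside C) KSym = After (C <#> K) \<one>"
| "act s y = Stuck"

fun valid :: "'a state \<Rightarrow> bool" where
  "valid (Before a) \<longleftrightarrow> a \<in> carrier G"
| "valid (Inside C) \<longleftrightarrow> C \<subseteq> carrier G"
| "valid (After D b) \<longleftrightarrow> b \<in> carrier G"
| "valid Stuck \<longleftrightarrow> True"

lemma valid_translate: "valid s \<Longrightarrow> g \<in> carrier G \<Longrightarrow> valid (translate s g)"
  by (cases s) (auto simp: r_coset_subset_G subset_iff r_coset_def)

lemma valid_act: "valid s \<Longrightarrow> y \<in> \<Sigma> \<Longrightarrow> valid (act s y)"
  using H_subset
  by (cases "(s, y)" rule: act.cases) (auto simp: symbols_def intro!: valid_translate)

lemma valid_foldl_act: "valid s \<Longrightarrow> t \<in> lists \<Sigma> \<Longrightarrow> valid (foldl act s t)"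
  by (induction t arbitrary: s) (auto simp: valid_act)

lemma translate_translate:
  "valid s \<Longrightarrow> g \<in> carrier G \<Longrightarrow> h \<in> carrier G \<Longrightarrow>
     translate (translate s g) h = translate s (g \<otimes> h)"
  by (cases s) (auto simp: m_assoc coset_mult_assoc)

text \<open>Successive letters translate by the successive factors of \<open>\<theta> w\<close>, so
  words with the same value act alike.\<close>

lemma foldl_act_map_Gen:
  "valid s \<Longrightarrow> w \<in> lists X \<Longrightarrow> foldl act s (map Gen w) = translate s (\<theta> w)"
proof (induction w arbitrary: s)
  case Nil
  then show ?case by (cases s) (auto simp: coset_mult_one)
next
  case (Cons x w)
  then have x: "x \<in> X" "w \<in> lists X" "\<theta> [x] \<in> carrier G" by auto
  have "foldl act s (map Gen (x # w)) = translate (translate s (\<theta> [x])) (\<theta> w)"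
    using Cons.IH[OF valid_translate] Cons.prems(1) x by simp
  then show ?case
    using Cons.prems(1) x theta_Cons[OF x(1,2)] translate_translate theta_closed by metis
qed

text \<open>Both sides of a rule of \<open>R\<close> have the same value. The other two kinds of
  rules preserve the state because \<open>H h = H\<close> for \<open>h \<in> H\<close> and
  \<open>C k K = C K\<close> for \<open>k \<in> K\<close>.\<close>

lemma foldl_act_rule:
  assumes "(l, r) \<in> R\<^sub>D" "valid s"
  shows "foldl act s l = foldl act s r"
proof -
  consider (R) l' r' where "(l', r') \<in> R" "l = map Gen l'" "r = map Gen r'"
    | (H) h where "h \<in> X\<^sub>H" "l = HSym # map Gen h" "r = [HSym]"
    | (K) k where "k \<in> X\<^sub>K" "l = map Gen k @ [KSym]" "r = [KSym]"
    using assms(1) by (auto simp: double_coset_rules_def)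
  then show ?thesis
  proof cases
    case R
    then have "l' \<in> lists X" "r' \<in> lists X"
      using rewriting_system by (auto simp: is_rewriting_system_def)
    moreover have "\<theta> l' = \<theta> r'"
      using calculation R(1) theta_eq_iff generated_congruence_rule[OF rewriting_system] by blast
    ultimately show ?thesis
      using R assms(2) by (simp add: foldl_act_map_Gen)
  next
    case H
    then have h: "h \<in> lists X" "\<theta> h \<in> H" "\<theta> h \<in> carrier G"
      using XH by (auto intro: generate.incl intro!: theta_closed)
    have "foldl act (Inside H) (map Gen h) = Inside H"
      using foldl_act_map_Gen[of "Inside H" h] h H_subset coset_join2[OF h(3) subgroup_H h(2)]
      by simp
    moreover have "foldl act Stuck (map Gen h) = Stuck"
      using foldl_act_map_Gen[of Stuck h] h by simp
    ultimately show ?thesis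
      using H by (cases s) auto
  next
    case K
    then have k: "k \<in> lists X" "\<theta> k \<in> K" "\<theta> k \<in> carrier G"
      using XK by (auto intro: generate.incl intro!: theta_closed)
    have "(C #> \<theta> k) <#> K = C <#> K" if "C \<subseteq> carrier G" for C
      using that k K_subset rcos_assoc_lcos[of C K "\<theta> k"] coset_join3[OF k(3) subgroup_K k(2)]
      by simp
    then show ?thesis
      using K k assms(2) by (cases s) (auto simp: foldl_act_map_Gen)
  qed
qed

lemma foldl_act_congruent:
  assumes "(t, t') \<in> C\<^sub>D"
  shows "foldl act (Before \<one>) t = foldl act (Before \<one>) t'"
proof (rule generated_congruence_invariant[OF assms])
  fix u l r v assume "(l, r) \<in> R\<^sub>D" "u \<in> lists \<Sigma>"
  then show "foldl act (Before \<one>) (u @ l @ v) = foldl act (Before \<one>) (u @ r @ v)"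
    using foldl_act_rule[OF _ valid_foldl_act[of "Before \<one>" u]] by simp
qed

lemma foldl_act_Stuck: "foldl act Stuck t = Stuck"
proof (induction t)
  case (Cons y t)
  then show ?case by (cases y) auto
qed simp

text \<open>In an \<open>After\<close> state either new symbol leads to \<open>Stuck\<close>, which
  is never left, so only generators can follow.\<close>

lemma foldl_act_from_After:
  "foldl act (After D b) t = After D' g \<Longrightarrow> t \<in> lists \<Sigma> \<Longrightarrow> b \<in> carrier G \<Longrightarrow>
     \<exists>w\<in>lists X. t = map Gen w \<and> D' = D \<and> g = b \<otimes> \<theta> w"
proof (induction t arbitrary: b)
  case Nil
  then show ?case by auto
next
  case (Cons y t)
  show ?case
  proof (cases y)
    case (Gen x)
    then have x: "x \<in> X" "\<theta> [x] \<in> carrier G"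
      using Cons.prems by (auto simp: symbols_def)
    then obtain w where w: "w \<in> lists X" "t = map Gen w" "D' = D" "g = b \<otimes> \<theta> [x] \<otimes> \<theta> w"
      using Cons.IH[of "b \<otimes> \<theta> [x]"] Cons.prems Gen by auto
    then show ?thesis
      using x Gen Cons.prems theta_Cons[OF x(1) w(1)] theta_closed[OF w(1)]
      by (intro bexI[of _ "x # w"]) (auto simp: m_assoc)
  qed (use Cons.prems in \<open>simp_all add: foldl_act_Stuck\<close>)
qed

text \<open>The word splits at its first \<open>KSym\<close>: the generators before it translate the
  coset, and \<open>foldl_act_from_After\<close> describes the rest.\<close>

lemma foldl_act_from_Inside:
  "foldl act (Inside C) t = After D g \<Longrightarrow> t \<in> lists \<Sigma> \<Longrightarrow> C \<subseteq> carrier G \<Longrightarrow>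
     \<exists>w\<in>lists X. \<exists>b\<in>lists X. t = map Gen w @ KSym # map Gen b \<and> D = (C #> \<theta> w) <#> K \<and> g = \<theta> b"
proof (induction t arbitrary: C)
  case Nil
  then show ?case by simp
next
  case (Cons y t)
  show ?case
  proof (cases y)
    case HSym
    then show ?thesis using Cons.prems by (simp add: foldl_act_Stuck)
  next
    case KSym
    then obtain b where "b \<in> lists X" "t = map Gen b" "D = C <#> K" "g = \<one> \<otimes> \<theta> b"
      using foldl_act_from_After[of "C <#> K" \<one> t D g] Cons.prems by auto
    then show ?thesis
      using KSym Cons.prems theta_closed[of b]
      by (intro bexI[of _ "[]"] bexI[of _ b]) (auto simp: coset_mult_one)
  next
    case (Gen x)
    then have x: "x \<in> X" "\<theta> [x] \<in> carrier G"
      using Cons.prems by (auto simp: symbols_def)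
    then obtain w b where w: "w \<in> lists X" "b \<in> lists X" "t = map Gen w @ KSym # map Gen b"
      "D = (C #> \<theta> [x] #> \<theta> w) <#> K" "g = \<theta> b"
      using Cons.IH[of "C #> \<theta> [x]"] Cons.prems Gen r_coset_subset_G by auto
    then show ?thesis
      using x Gen Cons.prems theta_Cons[OF x(1) w(1)] theta_closed[OF w(1)]
      by (intro bexI[of _ "x # w"] bexI[of _ b]) (auto simp: coset_mult_assoc)
  qed
qed

text \<open>The word splits at its first \<open>HSym\<close>, which avoids \<open>Stuck\<close> only
  if the value read so far is \<open>\<one>\<close>.\<close>

lemma foldl_act_from_Before:
  "foldl act (Before a) t = After D g \<Longrightarrow> t \<in> lists \<Sigma> \<Longrightarrow> a \<in> carrier G \<Longrightarrow>
     \<exists>v\<in>lists X. \<exists>t'\<in>lists \<Sigma>. t = map Gen v @ HSym # t' \<and> a \<otimes> \<theta> v = \<one> \<and>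
       foldl act (Inside H) t' = After D g"
proof (induction t arbitrary: a)
  case Nil
  then show ?case by simp
next
  case (Cons y t)
  show ?case
  proof (cases y)
    case KSym
    then show ?thesis using Cons.prems by (simp add: foldl_act_Stuck)
  next
    case HSym
    then show ?thesis
      using Cons.prems
      by (intro bexI[of _ "[]"] bexI[of _ t]) (auto simp: foldl_act_Stuck split: if_splits)
  next
    case (Gen x)
    then have x: "x \<in> X" "\<theta> [x] \<in> carrier G"
      using Cons.prems by (auto simp: symbols_def)
    then obtain v t' where v: "v \<in> lists X" "t' \<in> lists \<Sigma>" "t = map Gen v @ HSym # t'"
      "a \<otimes> \<theta> [x] \<otimes> \<theta> v = \<one>" "foldl act (Inside H) t' = After D g"
      using Cons.IH[of "a \<otimes> \<theta> [x]"] Cons.prems Gen by auto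
    then show ?thesis
      using x Gen Cons.prems theta_Cons[OF x(1) v(1)] theta_closed[OF v(1)]
      by (intro bexI[of _ "x # v"] bexI[of _ t']) (auto simp: m_assoc)
  qed
qed

lemma foldl_act_HK_word:
  assumes "w \<in> lists X"
  shows "foldl act (Before \<one>) (HK_word w) = After ((H #> \<theta> w) <#> K) \<one>"
  using assms H_subset foldl_act_map_Gen[of "Inside H" w] by (simp add: HK_word_def)

lemma HK_word_in_lists: "w \<in> lists X \<Longrightarrow> HK_word w \<in> lists \<Sigma>"
  by (auto simp: HK_word_def symbols_def)

text \<open>The words \<open>a\<close> and \<open>b\<close> cannot be avoided, since a relator may be inserted anywhere.\<close>

lemma congruent_HK_word_shape:
  assumes "w \<in> lists X" "(HK_word w, t) \<in> C\<^sub>D"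
  obtains a w' b where "a \<in> lists X" "w' \<in> lists X" "b \<in> lists X"
    "t = map Gen a @ HK_word w' @ map Gen b" "\<theta> a = \<one>" "\<theta> b = \<one>"
    "(H #> \<theta> w') <#> K = (H #> \<theta> w) <#> K"
proof -
  have t: "t \<in> lists \<Sigma>"
    using generated_congruence_in_lists[OF assms(2)] by simp
  have "foldl act (Before \<one>) t = After ((H #> \<theta> w) <#> K) \<one>"
    using foldl_act_congruent[OF assms(2)] foldl_act_HK_word[OF assms(1)] by simp
  then obtain a t' where a: "a \<in> lists X" "t' \<in> lists \<Sigma>" "t = map Gen a @ HSym # t'"
    "\<one> \<otimes> \<theta> a = \<one>" "foldl act (Inside H) t' = After ((H #> \<theta> w) <#> K) \<one>"
    using foldl_act_from_Before[OF _ t] by blast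
  obtain w' b where "w' \<in> lists X" "b \<in> lists X" "t' = map Gen w' @ KSym # map Gen b"
    "(H #> \<theta> w) <#> K = (H #> \<theta> w') <#> K" "\<one> = \<theta> b"
    using foldl_act_from_Inside[OF a(5,2) H_subset] by blast
  with a show ?thesis
    by (intro that[of a w' b]) (simp_all add: HK_word_def)
qed

section \<open>Words for the same double coset are congruent\<close>

lemma map_Gen_congruent:
  assumes "u \<in> lists X" "v \<in> lists X" "\<theta> u = \<theta> v"
  shows "(map Gen u, map Gen v) \<in> C\<^sub>D"
proof -
  \<comment> \<open>The rules of \<open>R\<close> occur in \<open>R\<^sub>D\<close> under
    \<open>Gen\<close>, so steps over \<open>X\<close> become steps over
    \<open>\<Sigma>\<close>.\<close>
  have "rewrite_step \<Sigma> R\<^sub>D (map Gen x) (map Gen y)" if step: "rewrite_step X R x y" for x y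
    using step
  proof cases
    case (1 l r p q)
    then have "rewrite_step \<Sigma> R\<^sub>D (map Gen p @ map Gen l @ map Gen q)
        (map Gen p @ map Gen r @ map Gen q)"
      by (intro rewrite_step.intros)
         (auto simp: double_coset_rules_def)
    then show ?thesis using 1 by simp
  qed
  moreover have "equivclp (rewrite_step X R) u v"
    using assms theta_eq_iff by (auto simp: generated_congruence_def)
  ultimately have "equivclp (rewrite_step \<Sigma> R\<^sub>D) (map Gen u) (map Gen v)"
    by (blast intro: equivclp_map)
  then show ?thesis
    using assms by (simp add: generated_congruence_def)
qed

text \<open>Induction on how \<open>g\<close> is generated. The inverse of a generator has no rule
  of its own and is absorbed by first applying a rule backwards.\<close>

lemma HSym_absorbs:
  assumes "g \<in> H"
  shows "\<exists>w\<in>lists X. \<theta> w = g \<and> (HSym # map Gen w, [HSym]) \<in> C\<^sub>D"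
  using assms
proof (induction g rule: generate.induct)
  case one
  then show ?case
    by (intro bexI[of _ "[]"]) (auto intro!: generated_congruence_refl simp: symbols_def)
next
  case (incl g)
  then obtain h where "h \<in> X\<^sub>H" "\<theta> h = g" by blast
  moreover from this have "(HSym # map Gen h, [HSym]) \<in> C\<^sub>D"
    by (intro generated_congruence_rule rewriting_system_double_coset)
       (auto simp: double_coset_rules_def)
  ultimately show ?case using XH by blast
next
  case (inv g)
  then obtain h where h: "h \<in> X\<^sub>H" "\<theta> h = g" by blast
  then have hX: "h \<in> lists X" "g \<in> carrier G" using XH theta_closed by blast+
  then obtain w where w: "w \<in> lists X" "\<theta> w = inv g"
    using theta_surj[of "inv g"] by auto
  have "(HSym # map Gen h, [HSym]) \<in> C\<^sub>D"
    using h by (intro generated_congruence_rule rewriting_system_double_coset)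
       (auto simp: double_coset_rules_def)
  \<comment> \<open>Read backwards, the rule turns \<open>H w\<close> into
    \<open>H h w\<close>.\<close>
  from generated_congruence_append[OF generated_congruence_sym[OF this]
      generated_congruence_refl[of "map Gen w"]]
  have "(HSym # map Gen w, HSym # map Gen (h @ w)) \<in> C\<^sub>D"
    using w by simp
  \<comment> \<open>As \<open>w\<close> represents the inverse of \<open>g\<close>, the word
    \<open>h @ w\<close> has value \<open>\<one>\<close> and can be erased.\<close>
  also have "(map Gen (h @ w), map Gen []) \<in> C\<^sub>D"
    using h hX w by (intro map_Gen_congruent) (auto simp: theta_append simp del: map_append)
  from generated_congruence_append[OF generated_congruence_refl[of "[HSym]"] this]
  have "(HSym # map Gen (h @ w), [HSym]) \<in> C\<^sub>D"
    by (simp add: symbols_def)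
  finally show ?case using w by blast
next
  case (eng g1 g2)
  then obtain u v where u: "u \<in> lists X" "\<theta> u = g1" "(HSym # map Gen u, [HSym]) \<in> C\<^sub>D"
    and v: "v \<in> lists X" "\<theta> v = g2" "(HSym # map Gen v, [HSym]) \<in> C\<^sub>D"
    by blast
  from generated_congruence_append[OF u(3) generated_congruence_refl[of "map Gen v"]]
  have "(HSym # map Gen (u @ v), HSym # map Gen v) \<in> C\<^sub>D"
    using v by simp
  also note v(3)
  finally show ?case
    using u v by (intro bexI[of _ "u @ v"]) (auto simp: theta_append)
qed

text \<open>The mirror image of \<open>HSym_absorbs\<close>: for an inverse, \<open>w K\<close>
  becomes \<open>w k K\<close> and then \<open>K\<close>.\<close>

lemma KSym_absorbs:
  assumes "g \<in> K"
  shows "\<exists>w\<in>lists X. \<theta> w = g \<and> (map Gen w @ [KSym], [KSym]) \<in> C\<^sub>D"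
  using assms
proof (induction g rule: generate.induct)
  case one
  then show ?case
    by (intro bexI[of _ "[]"]) (auto intro!: generated_congruence_refl simp: symbols_def)
next
  case (incl g)
  then obtain k where "k \<in> X\<^sub>K" "\<theta> k = g" by blast
  moreover from this have "(map Gen k @ [KSym], [KSym]) \<in> C\<^sub>D"
    by (intro generated_congruence_rule rewriting_system_double_coset)
       (auto simp: double_coset_rules_def)
  ultimately show ?case using XK by blast
next
  case (inv g)
  then obtain k where k: "k \<in> X\<^sub>K" "\<theta> k = g" by blast
  then have kX: "k \<in> lists X" "g \<in> carrier G" using XK theta_closed by blast+
  then obtain w where w: "w \<in> lists X" "\<theta> w = inv g"
    using theta_surj[of "inv g"] by auto
  have "(map Gen k @ [KSym], [KSym]) \<in> C\<^sub>D"
    using k by (intro generated_congruence_rule rewriting_system_double_coset)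
       (auto simp: double_coset_rules_def)
  from generated_congruence_append[OF generated_congruence_refl[of "map Gen w"]
      generated_congruence_sym[OF this]]
  have "(map Gen w @ [KSym], map Gen (w @ k) @ [KSym]) \<in> C\<^sub>D"
    using w by simp
  also have "(map Gen (w @ k), map Gen []) \<in> C\<^sub>D"
    using k kX w by (intro map_Gen_congruent) (auto simp: theta_append simp del: map_append)
  from generated_congruence_append[OF this generated_congruence_refl[of "[KSym]"]]
  have "(map Gen (w @ k) @ [KSym], [KSym]) \<in> C\<^sub>D"
    by (simp add: symbols_def)
  finally show ?case using w by blast
next
  case (eng g1 g2)
  then obtain u v where u: "u \<in> lists X" "\<theta> u = g1" "(map Gen u @ [KSym], [KSym]) \<in> C\<^sub>D"
    and v: "v \<in> lists X" "\<theta> v = g2" "(map Gen v @ [KSym], [KSym]) \<in> C\<^sub>D"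
    by blast
  from generated_congruence_append[OF generated_congruence_refl[of "map Gen u"] v(3)]
  have "(map Gen (u @ v) @ [KSym], map Gen u @ [KSym]) \<in> C\<^sub>D"
    using u by simp
  also note u(3)
  finally show ?case
    using u v by (intro bexI[of _ "u @ v"]) (auto simp: theta_append)
qed

text \<open>The chain is \<open>H v K ~ H c u d K ~ H u K\<close>, where \<open>c\<close> and
  \<open>d\<close> are words for \<open>g\<close> and \<open>k\<close> that the two new symbols
  absorb.\<close>

lemma HK_word_congruent:
  assumes u: "u \<in> lists X" and v: "v \<in> lists X"
    and g: "g \<in> H" "k \<in> K" "\<theta> v = g \<otimes> \<theta> u \<otimes> k"
  shows "(HK_word v, HK_word u) \<in> C\<^sub>D"
proof -
  obtain c where c: "c \<in> lists X" "\<theta> c = g" "(HSym # map Gen c, [HSym]) \<in> C\<^sub>D"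
    using HSym_absorbs[OF g(1)] by blast
  obtain d where d: "d \<in> lists X" "\<theta> d = k" "(map Gen d @ [KSym], [KSym]) \<in> C\<^sub>D"
    using KSym_absorbs[OF g(2)] by blast
  have "c @ u @ d \<in> lists X" using c d u by simp
  moreover have "\<theta> v = \<theta> (c @ u @ d)"
    using c(1) d(1) u unfolding g(3) c(2)[symmetric] d(2)[symmetric]
    by (simp add: theta_append m_assoc)
  ultimately have "(map Gen v, map Gen (c @ u @ d)) \<in> C\<^sub>D"
    using v by (intro map_Gen_congruent)
  from generated_congruence_context[OF this, of "[HSym]" "[KSym]"]
  have "(HK_word v, HK_word (c @ u @ d)) \<in> C\<^sub>D"
    by (simp add: HK_word_def symbols_def)
  also from generated_congruence_append[OF c(3)
      generated_congruence_append[OF generated_congruence_refl[of "map Gen u"] d(3)]]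
  have "(HK_word (c @ u @ d), HK_word u) \<in> C\<^sub>D"
    using u by (simp add: HK_word_def)
  finally show ?thesis .
qed

text \<open>Links the equivalence classes to the set products \<open>H g K\<close> that the
  automaton computes.\<close>

lemma double_coset_Image:
  assumes "g \<in> carrier G"
  shows "double_coset_rel G H K `` {g} = (H #> g) <#> K"
proof
  show "double_coset_rel G H K `` {g} \<subseteq> (H #> g) <#> K"
    by (auto simp: double_coset_rel_def r_coset_def set_mult_def)
  show "(H #> g) <#> K \<subseteq> double_coset_rel G H K `` {g}"
    using assms H_subset K_subset
    by (auto simp: double_coset_rel_def r_coset_def set_mult_def subset_iff)
qed

lemma mem_double_coset:
  assumes "g \<in> carrier G"
  shows "g \<in> (H #> g) <#> K"
proof -
  have "g = \<one> \<otimes> g \<otimes> \<one>" "\<one> \<in> H" "\<one> \<in> K"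
    using assms by (auto intro: generate.one)
  then show ?thesis
    unfolding r_coset_def set_mult_def by blast
qed

section \<open>Finiteness of the alphabet and of the quotients\<close>

lemma generator_occurs:
  assumes C: "generated_congruence \<Sigma> R\<^sub>C = C\<^sub>D" and x: "x \<in> X"
  shows "\<exists>(l, r)\<in>R\<^sub>C. Gen x \<in> set l \<union> set r"
proof (rule ccontr)
  assume no: "\<not> ?thesis"
  obtain w where w: "w \<in> lists X" "\<theta> w = inv (\<theta> [x])"
    using theta_surj[of "inv (\<theta> [x])"] x by auto
  \<comment> \<open>The letter \<open>x\<close> followed by a word for its inverse is congruent to
    the empty word.\<close>
  have "(map Gen (x # w), map Gen []) \<in> C\<^sub>D"
    using x w theta_Cons[OF x w(1)] theta_closed[of "[x]"] by (intro map_Gen_congruent) auto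
  then have "(map Gen (x # w), []) \<in> generated_congruence \<Sigma> R\<^sub>C"
    using C by simp
  \<comment> \<open>If no rule contains \<open>Gen x\<close>, rewriting never changes its
    occurrences; yet it occurs on the left and not on the right.\<close>
  then have "filter (\<lambda>y. y = Gen x) (map Gen (x # w)) = filter (\<lambda>y. y = Gen x) []"
  proof (rule generated_congruence_invariant)
    fix u l r v assume "(l, r) \<in> R\<^sub>C"
    then have "filter (\<lambda>y. y = Gen x) l = []" "filter (\<lambda>y. y = Gen x) r = []"
      using no by (auto simp: filter_empty_conv)
    then show "filter (\<lambda>y. y = Gen x) (u @ l @ v) = filter (\<lambda>y. y = Gen x) (u @ r @ v)"
      by simp
  qed
  then show False by simp
qed

lemma finite_symbols:
  assumes "generated_congruence \<Sigma> R\<^sub>C = C\<^sub>D" "finite R\<^sub>C"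
  shows "finite \<Sigma>"
proof (rule finite_subset)
  show "\<Sigma> \<subseteq> {HSym, KSym} \<union> (\<Union>(l, r)\<in>R\<^sub>C. set l \<union> set r)"
    using generator_occurs[OF assms(1)] by (fastforce simp: symbols_def)
  show "finite ({HSym, KSym} \<union> (\<Union>(l, r)\<in>R\<^sub>C. set l \<union> set r))"
    using assms(2) by auto
qed

text \<open>The possible quotients are the states of an automaton for \<open>H X* K\<close>: nothing
  read, \<open>H\<close> and some generators read, the final \<open>K\<close> read, and
  failure.\<close>

lemma HK_words_quotients: "finite ((\<lambda>t. left_quotient t (HK_words X)) ` lists \<Sigma>)"
proof (rule finite_subset)
  define T where "T = {map Gen w @ [KSym] | w. w \<in> lists X}"
  have quot_Cons: "left_quotient (y # t) M = left_quotient t (left_quotient [y] M)"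
    for y :: "'b symbol" and t M
    by (simp add: left_quotient_def)
  have quot_Nil: "left_quotient [] M = M" for M :: "'b symbol list set"
    by (simp add: left_quotient_def)
  have empty: "left_quotient t {} = {}" for t :: "'b symbol list"
    by (simp add: left_quotient_def)
  have unit: "left_quotient t {[]} \<in> {{[]}, {}}" for t :: "'b symbol list"
    by (cases t) (auto simp: left_quotient_def)
  have T_Gen: "left_quotient [Gen x] T = (if x \<in> X then T else {})" for x
  proof -
    have "Gen x # v \<in> T \<longleftrightarrow> x \<in> X \<and> v \<in> T" for v
    proof
      assume "Gen x # v \<in> T"
      then obtain w where "w \<in> lists X" "Gen x # v = map Gen w @ [KSym]"
        unfolding T_def by blast
      then show "x \<in> X \<and> v \<in> T"
        unfolding T_def by (cases w) auto
    next
      assume "x \<in> X \<and> v \<in> T"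
      then obtain w where "x # w \<in> lists X" "Gen x # v = map Gen (x # w) @ [KSym]"
        unfolding T_def by auto
      then show "Gen x # v \<in> T"
        unfolding T_def by blast
    qed
    then show ?thesis by (simp add: left_quotient_def)
  qed
  have T_HSym: "left_quotient [HSym] T = {}" and T_KSym: "left_quotient [KSym] T = {[]}"
    by (auto simp: left_quotient_def T_def Cons_eq_append_conv)
  have T: "left_quotient t T \<in> {T, {[]}, {}}" for t
  proof (induction t)
    case Nil
    show ?case by (simp add: quot_Nil)
  next
    case (Cons y t)
    show ?case
      using Cons.IH unit[of t] unfolding quot_Cons[of y t T]
      by (cases y) (auto simp: T_Gen T_HSym T_KSym empty)
  qed
  have HSym: "left_quotient [HSym] (HK_words X) = T"
    and other: "y \<noteq> HSym \<Longrightarrow> left_quotient [y] (HK_words X) = {}" for y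
    by (auto simp: left_quotient_def HK_words_def HK_word_def T_def)
  have "left_quotient t (HK_words X) \<in> {HK_words X, T, {[]}, {}}" for t
  proof (cases t)
    case (Cons y t')
    then show ?thesis
      using T[of t'] HSym other[of y] unfolding Cons quot_Cons[of y t']
      by (cases "y = HSym") (auto simp: empty)
  qed (simp add: quot_Nil)
  then show "(\<lambda>t. left_quotient t (HK_words X)) ` lists \<Sigma> \<subseteq> {HK_words X, T, {[]}, {}}"
    by blast
qed simp

section \<open>Normal forms represent the double cosets\<close>

lemma normal_form_HK_word:
  assumes C: "generated_congruence \<Sigma> R\<^sub>C = C\<^sub>D" and R\<^sub>C: "complete_rewriting_system \<Sigma> R\<^sub>C"
    and w: "w \<in> lists X"
  obtains w' where "w' \<in> lists X" "avoids (fst ` R\<^sub>C) (HK_word w')"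
    "(H #> \<theta> w') <#> K = (H #> \<theta> w) <#> K"
proof -
  obtain t where t: "(HK_word w, t) \<in> C\<^sub>D" "avoids (fst ` R\<^sub>C) t"
    using normal_form_exists[OF R\<^sub>C HK_word_in_lists[OF w]] C by metis
  obtain a w' b where t': "a \<in> lists X" "w' \<in> lists X" "b \<in> lists X"
    "t = map Gen a @ HK_word w' @ map Gen b" "\<theta> a = \<one>" "\<theta> b = \<one>"
    "(H #> \<theta> w') <#> K = (H #> \<theta> w) <#> K"
    using congruent_HK_word_shape[OF w t(1)] by blast
  \<comment> \<open>Here \<open>c\<close> stands for either outer word: it is irreducible as a
    factor of \<open>t\<close>, and its trivial value makes it congruent to the empty word.\<close>
  have "map Gen c = []" if "c \<in> lists X" "\<theta> c = \<one>" "sublist (map Gen c) t" for c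
    using that normal_form_Nil[OF R\<^sub>C avoids_sublist[OF t(2) that(3)]] C
      map_Gen_congruent[of c "[]"] by simp
  then have "map Gen a = []" "map Gen b = []"
    using t' by (auto simp: sublist_append)
  then show ?thesis
    using that t(2) t' by simp
qed

theorem regular_normal_forms:
  assumes fin: "finite R\<^sub>C" and C: "generated_congruence \<Sigma> R\<^sub>C = C\<^sub>D"
    and R\<^sub>C: "complete_rewriting_system \<Sigma> R\<^sub>C"
  defines "L \<equiv> HK_words X \<inter> Collect (avoids (fst ` R\<^sub>C))"
  shows "regular_over \<Sigma> L"
    and "bij_betw (\<lambda>t. (H #> \<theta> (HK_inner t)) <#> K) L (double_cosets G H K)"
proof -
  note fin\<Sigma> = finite_symbols[OF C fin]
  show "regular_over \<Sigma> L"
    unfolding L_def using fin fin\<Sigma> HK_word_in_lists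
    by (intro regular_over_finite_quotients finite_quotients_Int HK_words_quotients
          finite_quotients_avoids)
       (auto simp: HK_words_def)
  show "bij_betw (\<lambda>t. (H #> \<theta> (HK_inner t)) <#> K) L (double_cosets G H K)"
  proof (rule bij_betw_imageI)
    show "inj_on (\<lambda>t. (H #> \<theta> (HK_inner t)) <#> K) L"
    proof (rule inj_onI)
      fix s t assume s: "s \<in> L" and t: "t \<in> L"
        and eq: "(H #> \<theta> (HK_inner s)) <#> K = (H #> \<theta> (HK_inner t)) <#> K"
      obtain v u where v: "v \<in> lists X" "s = HK_word v" and u: "u \<in> lists X" "t = HK_word u"
        using s t by (auto simp: L_def HK_words_def)
      \<comment> \<open>A double coset contains its representative; equality of the two thus yields
        the elements \<open>h\<close> and \<open>k\<close> needed for congruence.\<close>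
      have "\<theta> v \<in> (H #> \<theta> u) <#> K"
        using mem_double_coset[OF theta_closed[OF v(1)]] eq u v by simp
      then obtain h k where "h \<in> H" "k \<in> K" "\<theta> v = h \<otimes> \<theta> u \<otimes> k"
        by (auto simp: r_coset_def set_mult_def)
      then have "(s, t) \<in> generated_congruence \<Sigma> R\<^sub>C"
        using HK_word_congruent[OF u(1) v(1)] u v C by simp
      then show "s = t"
        using normal_form_unique[OF R\<^sub>C] s t by (simp add: L_def)
    qed
    show "(\<lambda>t. (H #> \<theta> (HK_inner t)) <#> K) ` L = double_cosets G H K"
    proof
      show "(\<lambda>t. (H #> \<theta> (HK_inner t)) <#> K) ` L \<subseteq> double_cosets G H K"
      proof
        fix D assume "D \<in> (\<lambda>t. (H #> \<theta> (HK_inner t)) <#> K) ` L"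
        then obtain t where "t \<in> HK_words X" "D = (H #> \<theta> (HK_inner t)) <#> K"
          unfolding L_def by blast
        then obtain w where "w \<in> lists X" "D = (H #> \<theta> w) <#> K"
          unfolding HK_words_def by (elim imageE) simp
        then show "D \<in> double_cosets G H K"
          using quotientI[OF theta_closed, of w "double_coset_rel G H K"]
            double_coset_Image[OF theta_closed, of w] by (simp add: double_cosets_def)
      qed
      show "double_cosets G H K \<subseteq> (\<lambda>t. (H #> \<theta> (HK_inner t)) <#> K) ` L"
      proof
        fix D assume "D \<in> double_cosets G H K"
        then obtain g where g: "g \<in> carrier G" "D = (H #> g) <#> K"
          using double_coset_Image by (auto simp: double_cosets_def elim!: quotientE)
        then obtain w where w: "w \<in> lists X" "\<theta> w = g"
          using theta_surj by blast
        \<comment> \<open>Passing from \<open>HK_word w\<close> to its normal form keeps the double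
          coset, so \<open>D\<close> is attained on \<open>L\<close>.\<close>
        obtain w' where "w' \<in> lists X" "avoids (fst ` R\<^sub>C) (HK_word w')" "(H #> \<theta> w') <#> K = D"
          using normal_form_HK_word[OF C R\<^sub>C w(1)] g w by metis
        then show "D \<in> (\<lambda>t. (H #> \<theta> (HK_inner t)) <#> K) ` L"
          by (intro image_eqI[of _ _ "HK_word w'"]) (auto simp: L_def HK_words_def)
      qed
    qed
  qed
qed

end

theorem mainTheorem5:
  fixes G :: "('g, 'm) monoid_scheme"
    and X\<^sub>G :: "'x set"
    and R\<^sub>G :: "'x rules"
    and \<theta> :: "'x list \<Rightarrow> 'g"
    and X\<^sub>H X\<^sub>K :: "'x list set"
    and H K :: "'g set"
    and R\<^sub>C :: "'x symbol rules"
  assumes "group_presentation G X\<^sub>G R\<^sub>G \<theta>"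
    and "X\<^sub>H \<subseteq> lists X\<^sub>G" and "H = generate G (\<theta> ` X\<^sub>H)"
    and "X\<^sub>K \<subseteq> lists X\<^sub>G" and "K = generate G (\<theta> ` X\<^sub>K)"
    and "finite R\<^sub>C"
    and "complete_rewriting_system (symbols X\<^sub>G) R\<^sub>C"
    and "generated_congruence (symbols X\<^sub>G) R\<^sub>C =
         generated_congruence (symbols X\<^sub>G) (double_coset_rules R\<^sub>G X\<^sub>H X\<^sub>K)"
  shows "\<exists>(e :: 'x symbol rexp) L.
           rexp_atoms e \<subseteq> symbols X\<^sub>G \<and> rexp_lang e = L \<and> L \<subseteq> HK_words X\<^sub>G \<and>
           bij_betw (\<lambda>t. (H #>\<^bsub>G\<^esub> \<theta> (HK_inner t)) <#>\<^bsub>G\<^esub> K) L (double_cosets G H K)"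
proof -
  have "group G"
    using assms(1) by (simp add: group_presentation_def)
  then interpret double_coset_presentation G X\<^sub>G R\<^sub>G \<theta> X\<^sub>H X\<^sub>K
    using assms(1,2,4)
    by (simp add: double_coset_presentation_def presented_group_def
        double_coset_presentation_axioms_def presented_group_axioms_def)
  let ?L = "HK_words X\<^sub>G \<inter> Collect (avoids (fst ` R\<^sub>C))"
  note L = regular_normal_forms[OF assms(6,8,7)]
  obtain e where "rexp_atoms e \<subseteq> symbols X\<^sub>G" "rexp_lang e = ?L"
    using L(1) unfolding regular_over_def by blast
  then show ?thesis
    using L(2) unfolding assms(3,5) by (intro exI[of _ e] exI[of _ ?L]) simp
qed

end
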